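(* A $2$-edge-coloured graph $G=(\Gamma,R,B)$ is chromatically invariant if and only if $G$ has no induced bichromatic $2$-path and $G$ contains no induced bichromatic copy of $2K_2$.
   Context: All graphs are finite and simple. A $2$-edge-coloured graph is a triple $G=(\Gamma,R,B)$ with $R,B\subseteq E(\Gamma)$, $R\cap B=\emptyset$, $R\cup B=E(\Gamma)$ (red and blue edges). A $k$-colouring of $G$ is a proper vertex colouring $c:V(\Gamma)\to\{1,\dots,k\}$ of $\Gamma$ such that for every $ux\in R$ and $vy\in B$ (either endpoint may play the role of $u$, resp. $v$), $c(u)=c(v)$ implies $c(x)\ne c(y)$. $P(G,\lambda)$ is the polynomial whose value at each non-negative integer $k$ is the number of $k$-colourings of $G$. $G$ is chromatically invariant if $P(G,\lambda)=P(\Gamma,\lambda)$, the usual chromatic polynomial of $\Gamma$. An induced bichromatic $2$-path is an induced path $xuy$ of $\Gamma$ (so $xy\notin E(\Gamma)$) with $xu\in R$ and $uy\in B$. An induced bichromatic copy of $2K_2$ consists of four distinct vertices $u,x,v,y$ with $ux\in R$, $vy\in B$ and no other edges of $\Gamma$ among $\{u,x,v,y\}$. *)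

theory Defs
  imports "HOL-Computational_Algebra.Polynomial" "HOL-Library.FuncSet"
begin

record 'a ugraph =
  verts :: "'a set"
  edges :: "'a set set"

definition simple_graph :: "'a ugraph \<Rightarrow> bool" where
  "simple_graph \<Gamma> \<longleftrightarrow> finite (verts \<Gamma>) \<and> (\<forall>e\<in>edges \<Gamma>. e \<subseteq> verts \<Gamma> \<and> card e = 2)"

record 'a two_ec_graph =
  underlying :: "'a ugraph"
  red :: "'a set set"
  blue :: "'a set set"

definition two_edge_coloured_graph :: "'a two_ec_graph \<Rightarrow> bool" where
  "two_edge_coloured_graph G \<longleftrightarrow> simple_graph (underlying G) \<and>
     red G \<subseteq> edges (underlying G) \<and> blue G \<subseteq> edges (underlying G) \<and>
     red G \<inter> blue G = {} \<and> red G \<union> blue G = edges (underlying G)"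

text \<open>Colourings are extensional functions (undefined outside the vertex set), so that
  counting them counts functions on the vertex set.\<close>

definition proper_colourings :: "'a ugraph \<Rightarrow> nat \<Rightarrow> ('a \<Rightarrow> nat) set" where
  "proper_colourings \<Gamma> k =
     {c \<in> verts \<Gamma> \<rightarrow>\<^sub>E {1..k}. \<forall>u x. {u, x} \<in> edges \<Gamma> \<longrightarrow> c u \<noteq> c x}"

text \<open>Since \<open>{u, x} = {x, u}\<close>, quantifying over ordered pairs lets either endpoint of the
  red (blue) edge play the role of \<open>u\<close> (\<open>v\<close>).\<close>

definition colourings :: "'a two_ec_graph \<Rightarrow> nat \<Rightarrow> ('a \<Rightarrow> nat) set" where
  "colourings G k =
     {c \<in> proper_colourings (underlying G) k.
        \<forall>u x v y. {u, x} \<in> red G \<and> {v, y} \<in> blue G \<longrightarrow> c u = c v \<longrightarrow> c x \<noteq> c y}"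

definition interpolating_poly :: "(nat \<Rightarrow> nat) \<Rightarrow> real poly" where
  "interpolating_poly f = (THE p. \<forall>k. poly p (of_nat k) = of_nat (f k))"

definition chromatic_poly :: "'a ugraph \<Rightarrow> real poly" where
  "chromatic_poly \<Gamma> = interpolating_poly (\<lambda>k. card (proper_colourings \<Gamma> k))"

definition chromatic_poly2 :: "'a two_ec_graph \<Rightarrow> real poly" where
  "chromatic_poly2 G = interpolating_poly (\<lambda>k. card (colourings G k))"

definition chromatically_invariant :: "'a two_ec_graph \<Rightarrow> bool" where
  "chromatically_invariant G \<longleftrightarrow> chromatic_poly2 G = chromatic_poly (underlying G)"

definition induced_bichromatic_2path :: "'a two_ec_graph \<Rightarrow> 'a \<Rightarrow> 'a \<Rightarrow> 'a \<Rightarrow> bool" where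
  "induced_bichromatic_2path G x u y \<longleftrightarrow>
     distinct [x, u, y] \<and> {x, u} \<in> red G \<and> {u, y} \<in> blue G \<and> {x, y} \<notin> edges (underlying G)"

definition induced_bichromatic_2K2 :: "'a two_ec_graph \<Rightarrow> 'a \<Rightarrow> 'a \<Rightarrow> 'a \<Rightarrow> 'a \<Rightarrow> bool" where
  "induced_bichromatic_2K2 G u x v y \<longleftrightarrow>
     distinct [u, x, v, y] \<and> {u, x} \<in> red G \<and> {v, y} \<in> blue G \<and>
     {u, v} \<notin> edges (underlying G) \<and> {u, y} \<notin> edges (underlying G) \<and>
     {x, v} \<notin> edges (underlying G) \<and> {x, y} \<notin> edges (underlying G)"


text \<open>The polynomials above are well defined: the description in \<open>interpolating_poly\<close> is
  satisfied by exactly one polynomial in both uses.\<close>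

lemma poly_eq_on_nats:
  fixes p q :: "real poly"
  assumes "\<And>k::nat. poly p (of_nat k) = poly q (of_nat k)"
  shows "p = q"
proof (rule ccontr)
  assume "p \<noteq> q"
  then have "finite {x. poly (p - q) x = 0}" by (intro poly_roots_finite) simp
  moreover have "range (of_nat :: nat \<Rightarrow> real) \<subseteq> {x. poly (p - q) x = 0}"
    using assms by auto
  ultimately have "finite (range (of_nat :: nat \<Rightarrow> real))" by (rule rev_finite_subset)
  then show False by (simp add: finite_image_iff inj_of_nat)
qed

lemma poly_interpolating_poly:
  assumes "\<exists>p. \<forall>k. poly p (of_nat k) = real (f k)"
  shows "poly (interpolating_poly f) (of_nat k) = real (f k)"
proof -
  have "\<exists>!p. \<forall>k. poly p (of_nat k) = real (f k)"
    using assms by (metis poly_eq_on_nats)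
  from theI'[OF this] show ?thesis unfolding interpolating_poly_def by blast
qed

lemma ex_counting_poly:
  fixes V :: "'a set" and Q :: "('a \<Rightarrow> nat) \<Rightarrow> bool"
  assumes fin: "finite V"
    and inv: "\<And>c d. (\<And>u v. u \<in> V \<Longrightarrow> v \<in> V \<Longrightarrow> c u = c v \<longleftrightarrow> d u = d v) \<Longrightarrow> Q c \<Longrightarrow> Q d"
  shows "\<exists>p. \<forall>k. poly p (of_nat k) = real (card {c \<in> V \<rightarrow>\<^sub>E {1..k}. Q c})"
proof -
  define A where "A S = {c \<in> V \<rightarrow>\<^sub>E S. c ` V = S \<and> Q c}" for S
  have finA: "finite (A S)" if "finite S" for S
    unfolding A_def using finite_PiE[OF fin, of "\<lambda>_. S"] that by simp
  have le: "card (A S) \<le> card (A T)" if "finite S" "finite T" "card S = card T" for S T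
  proof -
    from that obtain h where h: "bij_betw h S T" using finite_same_card_bij by blast
    then have hi: "inj_on h S" and hT: "h ` S = T" by (auto simp: bij_betw_def)
    show ?thesis
    proof (rule card_inj_on_le[where f = "\<lambda>c. restrict (h \<circ> c) V"])
      show "inj_on (\<lambda>c. restrict (h \<circ> c) V) (A S)"
      proof (rule inj_onI)
        fix c d assume c: "c \<in> A S" and d: "d \<in> A S"
          and eq: "restrict (h \<circ> c) V = restrict (h \<circ> d) V"
        show "c = d"
        proof (rule PiE_ext)
          show "c \<in> V \<rightarrow>\<^sub>E S" "d \<in> V \<rightarrow>\<^sub>E S" using c d by (auto simp: A_def)
          fix v assume v: "v \<in> V"
          then have "h (c v) = h (d v)" using fun_cong[OF eq, of v] by simp
          moreover have "c v \<in> S" "d v \<in> S" using c d v by (auto simp: A_def)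
          ultimately show "c v = d v" using hi by (auto dest: inj_onD)
        qed
      qed
      show "(\<lambda>c. restrict (h \<circ> c) V) ` A S \<subseteq> A T"
      proof (rule image_subsetI)
        fix c assume c: "c \<in> A S"
        then have cV: "c ` V = S" and Qc: "Q c" by (auto simp: A_def)
        have img: "restrict (h \<circ> c) V ` V = T" using cV hT by (auto simp: image_iff)
        have "Q (restrict (h \<circ> c) V)"
        proof (rule inv[OF _ Qc])
          fix u v assume "u \<in> V" "v \<in> V"
          then show "c u = c v \<longleftrightarrow> restrict (h \<circ> c) V u = restrict (h \<circ> c) V v"
            using cV hi by (auto dest: inj_onD)
        qed
        moreover have "restrict (h \<circ> c) V \<in> V \<rightarrow>\<^sub>E T" using img by auto
        ultimately show "restrict (h \<circ> c) V \<in> A T" using img by (simp add: A_def)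
      qed
      show "finite (A T)" using finA that by blast
    qed
  qed
  have cardA: "card (A S) = card (A {1..card S})" if "finite S" for S
    using le[of S "{1..card S}"] le[of "{1..card S}" S] that by simp
  have count: "card {c \<in> V \<rightarrow>\<^sub>E {1..k}. Q c}
      = (\<Sum>m\<le>card V. (k choose m) * card (A {1..m}))" for k
  proof -
    define I where "I = {S. S \<subseteq> {1..k} \<and> card S \<le> card V}"
    have finI: "finite I" unfolding I_def by simp
    have finS: "finite S" if "S \<in> I" for S
      using that finite_subset[of S "{1..k}"] by (auto simp: I_def)
    have "{c \<in> V \<rightarrow>\<^sub>E {1..k}. Q c} = (\<Union>S\<in>I. A S)"
    proof (intro equalityI subsetI)
      fix c assume c: "c \<in> {c \<in> V \<rightarrow>\<^sub>E {1..k}. Q c}"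
      then have "c ` V \<in> I" using card_image_le[OF fin, of c] by (auto simp: I_def)
      moreover have "c \<in> A (c ` V)" using c by (auto simp: A_def PiE_iff)
      ultimately show "c \<in> (\<Union>S\<in>I. A S)" by blast
    next
      fix c assume "c \<in> (\<Union>S\<in>I. A S)"
      then show "c \<in> {c \<in> V \<rightarrow>\<^sub>E {1..k}. Q c}"
        unfolding A_def I_def PiE_iff by blast
    qed
    also have "card \<dots> = (\<Sum>S\<in>I. card (A S))"
    proof (rule card_UN_disjoint)
      show "\<forall>S\<in>I. \<forall>T\<in>I. S \<noteq> T \<longrightarrow> A S \<inter> A T = {}" unfolding A_def by blast
    qed (use finI finS finA in auto)
    also have "\<dots> = (\<Sum>m\<le>card V. \<Sum>S | S \<in> I \<and> card S = m. card (A S))"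
      by (rule sum.group[symmetric]) (use finI in \<open>auto simp: I_def\<close>)
    also have "\<dots> = (\<Sum>m\<le>card V. (k choose m) * card (A {1..m}))"
    proof (rule sum.cong[OF refl])
      fix m assume m: "m \<in> {..card V}"
      have Im: "{S. S \<in> I \<and> card S = m} = {S. S \<subseteq> {1..k} \<and> card S = m}"
        using m by (auto simp: I_def)
      have "(\<Sum>S | S \<in> I \<and> card S = m. card (A S)) = (\<Sum>S | S \<in> I \<and> card S = m. card (A {1..m}))"
      proof (rule sum.cong[OF refl])
        fix S assume "S \<in> {S. S \<in> I \<and> card S = m}"
        then show "card (A S) = card (A {1..m})" using cardA[OF finS, of S] by blast
      qed
      also have "\<dots> = (k choose m) * card (A {1..m})"
        unfolding Im using n_subsets[of "{1..k}" m] by simp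
      finally show "(\<Sum>S | S \<in> I \<and> card S = m. card (A S)) = (k choose m) * card (A {1..m})" .
    qed
    finally show ?thesis .
  qed
  define p :: "real poly" where
    "p = (\<Sum>m\<le>card V. smult (card (A {1..m}) / fact m) (\<Prod>i = 0..<m. [:- of_nat i, 1:]))"
  have "poly p (of_nat k) = real (card {c \<in> V \<rightarrow>\<^sub>E {1..k}. Q c})" for k
    unfolding count p_def
    by (simp add: poly_sum poly_prod binomial_gbinomial gbinomial_prod_rev mult.commute)
  then show ?thesis by blast
qed

lemma simple_graph_edgeD:
  assumes "simple_graph \<Gamma>" "{u, x} \<in> edges \<Gamma>"
  shows "u \<in> verts \<Gamma>" "x \<in> verts \<Gamma>"
  using assms by (auto simp: simple_graph_def)

lemma poly_chromatic_poly:
  assumes "simple_graph \<Gamma>"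
  shows "poly (chromatic_poly \<Gamma>) (of_nat k) = real (card (proper_colourings \<Gamma> k))"
  unfolding chromatic_poly_def
proof (rule poly_interpolating_poly)
  show "\<exists>p. \<forall>k. poly p (of_nat k) = real (card (proper_colourings \<Gamma> k))"
    unfolding proper_colourings_def
  proof (rule ex_counting_poly)
    show "finite (verts \<Gamma>)" using assms by (simp add: simple_graph_def)
      fix c d :: "'a \<Rightarrow> nat"
    assume cd: "\<And>u v. u \<in> verts \<Gamma> \<Longrightarrow> v \<in> verts \<Gamma> \<Longrightarrow> c u = c v \<longleftrightarrow> d u = d v"
      and c: "\<forall>u x. {u, x} \<in> edges \<Gamma> \<longrightarrow> c u \<noteq> c x"
    show "\<forall>u x. {u, x} \<in> edges \<Gamma> \<longrightarrow> d u \<noteq> d x"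
    proof (intro allI impI)
      fix u x assume "{u, x} \<in> edges \<Gamma>"
      then show "d u \<noteq> d x" using cd[of u x] simple_graph_edgeD[OF assms, of u x] c by blast
    qed
  qed
qed

lemma poly_chromatic_poly2:
  assumes "two_edge_coloured_graph G"
  shows "poly (chromatic_poly2 G) (of_nat k) = real (card (colourings G k))"
  unfolding chromatic_poly2_def
proof (rule poly_interpolating_poly)
  let ?\<Gamma> = "underlying G"
  let ?Q = "\<lambda>c. (\<forall>u x. {u, x} \<in> edges ?\<Gamma> \<longrightarrow> c u \<noteq> c x) \<and>
    (\<forall>u x v y. {u, x} \<in> red G \<and> {v, y} \<in> blue G \<longrightarrow> c u = c v \<longrightarrow> c x \<noteq> c y)"
  have s: "simple_graph ?\<Gamma>" using assms by (simp add: two_edge_coloured_graph_def)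
  have V: "u \<in> verts ?\<Gamma>" "x \<in> verts ?\<Gamma>"
    if "{u, x} \<in> edges ?\<Gamma> \<or> {u, x} \<in> red G \<or> {u, x} \<in> blue G" for u x
    using that assms simple_graph_edgeD[OF s] unfolding two_edge_coloured_graph_def by blast+
  have eq: "colourings G k = {c \<in> verts ?\<Gamma> \<rightarrow>\<^sub>E {1..k}. ?Q c}" for k
    unfolding colourings_def proper_colourings_def by blast
  show "\<exists>p. \<forall>k. poly p (of_nat k) = real (card (colourings G k))"
    unfolding eq
  proof (rule ex_counting_poly)
    show "finite (verts ?\<Gamma>)" using s by (simp add: simple_graph_def)
    fix c d :: "'a \<Rightarrow> nat"
    assume cd: "\<And>u v. u \<in> verts ?\<Gamma> \<Longrightarrow> v \<in> verts ?\<Gamma> \<Longrightarrow> c u = c v \<longleftrightarrow> d u = d v" and Q: "?Q c"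
    show "?Q d"
    proof (intro conjI allI impI)
      fix u x assume "{u, x} \<in> edges ?\<Gamma>"
      then show "d u \<noteq> d x" using cd[of u x] V[of u x] Q by blast
    next
      fix u x v y assume e: "{u, x} \<in> red G \<and> {v, y} \<in> blue G" and "d u = d v"
      then have "c u = c v" using cd[of u v] V[of u x] V[of v y] by blast
      then have "c x \<noteq> c y" using Q e by blast
      then show "d x \<noteq> d y" using cd[of x y] V[of u x] V[of v y] e by blast
    qed
  qed
qed

end

theory Submission
  imports Defs
begin

text \<open>Every colouring of \<open>G\<close> is a proper colouring of \<open>\<Gamma>\<close>, so \<open>G\<close> is chromatically invariant
  iff every proper colouring of \<open>\<Gamma>\<close> is a colouring of \<open>G\<close>. Given an induced bichromatic
  2-path (or \<open>2K\<^sub>2\<close>), the proper colouring that only identifies its ends (or \<open>u\<close> with \<open>v\<close> and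
  \<open>x\<close> with \<open>y\<close>) is not a colouring of \<open>G\<close>. Conversely, a proper colouring violating the condition at a red
  \<open>ux\<close> and a blue \<open>vy\<close> forces \<open>uv\<close> and \<open>xy\<close> to be non-edges; if \<open>uy\<close> or \<open>xv\<close> is an edge then,
  whatever its colour, it forms an induced bichromatic 2-path with one of \<open>ux\<close>, \<open>vy\<close>.\<close>

text \<open>Polynomials that agree at all naturals are equal, and a subset of a finite set with the
  same cardinality is the whole set.\<close>

lemma chromatically_invariant_iff:
  assumes G: "two_edge_coloured_graph G"
  shows "chromatically_invariant G \<longleftrightarrow> (\<forall>k. colourings G k = proper_colourings (underlying G) k)"
proof -
  have s: "simple_graph (underlying G)"
    using G by (simp add: two_edge_coloured_graph_def)
  have eq: "card (colourings G k) = card (proper_colourings (underlying G) k) \<longleftrightarrow>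
    colourings G k = proper_colourings (underlying G) k" for k
  proof -
    have "finite (proper_colourings (underlying G) k)"
      using s finite_PiE[of "verts (underlying G)" "\<lambda>_. {1..k}"]
      by (simp add: proper_colourings_def simple_graph_def)
    moreover have "colourings G k \<subseteq> proper_colourings (underlying G) k"
      by (auto simp: colourings_def)
    ultimately show ?thesis by (metis card_subset_eq)
  qed
  have "chromatically_invariant G \<longleftrightarrow>
    (\<forall>k. card (colourings G k) = card (proper_colourings (underlying G) k))"
    unfolding chromatically_invariant_def
    by (metis of_nat_eq_iff poly_eq_on_nats poly_chromatic_poly[OF s] poly_chromatic_poly2[OF G])
  then show ?thesis using eq by simp
qed

text \<open>Think of \<open>f\<close> as choosing a representative vertex: its fibres are
  independent sets by \<open>ne\<close>, so they can serve as colour classes.\<close>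

lemma proper_colouring_identifying:
  assumes s: "simple_graph \<Gamma>"
    and f: "f \<in> verts \<Gamma> \<rightarrow> verts \<Gamma>"
    and ne: "\<And>a b. {a, b} \<in> edges \<Gamma> \<Longrightarrow> f a \<noteq> f b"
  obtains c k where "c \<in> proper_colourings \<Gamma> k"
    and "\<And>a b. a \<in> verts \<Gamma> \<Longrightarrow> b \<in> verts \<Gamma> \<Longrightarrow> c a = c b \<longleftrightarrow> f a = f b"
proof -
  let ?V = "verts \<Gamma>"
  have "finite ?V" using s by (simp add: simple_graph_def)
  \<comment> \<open>Numbering the vertices injectively turns representatives into colours, so
    \<open>card ?V\<close> colours suffice.\<close>
  then obtain h where h: "bij_betw h ?V {1..card ?V}"
    using finite_same_card_bij[of ?V "{1..card ?V}"] by auto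
  let ?c = "restrict (h \<circ> f) ?V"
  have c: "?c a = ?c b \<longleftrightarrow> f a = f b" if "a \<in> ?V" "b \<in> ?V" for a b
    using that f bij_betw_imp_inj_on[OF h] by (auto simp: Pi_iff dest: inj_onD)
  moreover have "?c \<in> ?V \<rightarrow>\<^sub>E {1..card ?V}"
    using f bij_betw_imp_funcset[OF h] by (auto simp: Pi_iff)
  then have "?c \<in> proper_colourings \<Gamma> (card ?V)"
    using c ne simple_graph_edgeD[OF s] unfolding proper_colourings_def by blast
  ultimately show thesis using that by blast
qed

lemma identification_imp_not_chromatically_invariant:
  assumes G: "two_edge_coloured_graph G"
    and f: "f \<in> verts (underlying G) \<rightarrow> verts (underlying G)"
    and ne: "\<And>a b. {a, b} \<in> edges (underlying G) \<Longrightarrow> f a \<noteq> f b"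
    and e: "{u, x} \<in> red G" "{v, y} \<in> blue G" "f u = f v" "f x = f y"
  shows "\<not> chromatically_invariant G"
proof -
  have s: "simple_graph (underlying G)"
    using G by (simp add: two_edge_coloured_graph_def)
  obtain c k where c: "c \<in> proper_colourings (underlying G) k"
    and cf: "\<And>a b. a \<in> verts (underlying G) \<Longrightarrow> b \<in> verts (underlying G) \<Longrightarrow>
      c a = c b \<longleftrightarrow> f a = f b"
    using proper_colouring_identifying[OF s f ne] by metis
  have "{u, x} \<in> edges (underlying G)" "{v, y} \<in> edges (underlying G)"
    using e G unfolding two_edge_coloured_graph_def by blast+
  then have "c u = c v" "c x = c y"
    using cf e simple_graph_edgeD[OF s] by blast+
  then have "c \<notin> colourings G k"
    using e unfolding colourings_def by blast
  then show ?thesis using c chromatically_invariant_iff[OF G] by blast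
qed

lemma edge_distinct:
  assumes "simple_graph \<Gamma>" "{a, b} \<in> edges \<Gamma>"
  shows "a \<noteq> b"
  using assms by (auto simp: simple_graph_def)

lemma induced_bichromatic_2path_not_invariant:
  assumes G: "two_edge_coloured_graph G" and P: "induced_bichromatic_2path G x u y"
  shows "\<not> chromatically_invariant G"
proof -
  have s: "simple_graph (underlying G)" and sub: "red G \<subseteq> edges (underlying G)"
    using G by (simp_all add: two_edge_coloured_graph_def)
  have p: "x \<noteq> u" "u \<noteq> y" "{u, x} \<in> red G" "{u, y} \<in> blue G"
    "{x, y} \<notin> edges (underlying G)" "{y, x} \<notin> edges (underlying G)"
    using P by (auto simp: induced_bichromatic_2path_def insert_commute)
  show ?thesis
  \<comment> \<open>The centre \<open>u\<close> serves as an end of both the red and the blue edge;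
    the only vertices merged are the non-adjacent \<open>x\<close> and \<open>y\<close>.\<close>
  proof (rule identification_imp_not_chromatically_invariant[OF G,
        where u = u and x = x and v = u and y = y])
    show "id(y := x) \<in> verts (underlying G) \<rightarrow> verts (underlying G)"
      using p sub simple_graph_edgeD[OF s, of u x] by auto
    show "(id(y := x)) a \<noteq> (id(y := x)) b" if "{a, b} \<in> edges (underlying G)" for a b
      using that p edge_distinct[OF s that] by auto
  qed (use p in auto)
qed

lemma induced_bichromatic_2K2_not_invariant:
  assumes G: "two_edge_coloured_graph G" and K: "induced_bichromatic_2K2 G u x v y"
  shows "\<not> chromatically_invariant G"
proof -
  have s: "simple_graph (underlying G)" and sub: "red G \<subseteq> edges (underlying G)"
    using G by (simp_all add: two_edge_coloured_graph_def)
  have p: "distinct [u, x, v, y]" "{u, x} \<in> red G" "{v, y} \<in> blue G"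
    "{u, v} \<notin> edges (underlying G)" "{v, u} \<notin> edges (underlying G)"
    "{x, y} \<notin> edges (underlying G)" "{y, x} \<notin> edges (underlying G)"
    using K by (auto simp: induced_bichromatic_2K2_def insert_commute)
  show ?thesis
  proof (rule identification_imp_not_chromatically_invariant[OF G,
        where u = u and x = x and v = v and y = y])
    \<comment> \<open>The only non-singleton fibres are the non-edges \<open>{u, v}\<close> and
      \<open>{x, y}\<close>.\<close>
    show "id(v := u, y := x) \<in> verts (underlying G) \<rightarrow> verts (underlying G)"
      using p sub simple_graph_edgeD[OF s, of u x] by auto
    show "(id(v := u, y := x)) a \<noteq> (id(v := u, y := x)) b"
      if "{a, b} \<in> edges (underlying G)" for a b
      using that p edge_distinct[OF s that] by auto
  qed (use p in auto)
qed

lemma proper_colouring_conflict: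
  assumes G: "two_edge_coloured_graph G"
    and c: "c \<in> proper_colourings (underlying G) k"
    and e: "{u, x} \<in> red G" "{v, y} \<in> blue G" "c u = c v" "c x = c y"
    and no_path: "\<And>a b d. \<not> induced_bichromatic_2path G a b d"
  shows "induced_bichromatic_2K2 G u x v y"
proof -
  let ?E = "edges (underlying G)"
  have col: "c a \<noteq> c b" if "{a, b} \<in> ?E" for a b
    using c that by (auto simp: proper_colourings_def)
  have E: "?E = red G \<union> blue G" and disj: "red G \<inter> blue G = {}"
    using G by (auto simp: two_edge_coloured_graph_def)
  \<comment> \<open>Equal colours exclude the edge \<open>{a, d}\<close>, so distinct ends would
    give an induced path.\<close>
  have path: "a = d" if "{a, b} \<in> red G" "{b, d} \<in> blue G" "c a = c d" for a b d
    using that no_path[of a b d] col[of a b] col[of b d] col[of a d]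
    by (auto simp: induced_bichromatic_2path_def E)
  \<comment> \<open>With \<open>c u = c v\<close> and \<open>c x = c y\<close> this also separates
    \<open>u\<close> from \<open>y\<close> and \<open>x\<close> from \<open>v\<close>.\<close>
  have ne: "c u \<noteq> c x" "c v \<noteq> c y" using col e E by blast+
  have e': "{x, u} \<in> red G" "{y, v} \<in> blue G"
    using e by (simp_all add: insert_commute)
  \<comment> \<open>Otherwise \<open>path\<close> yields \<open>x = y\<close>, and one edge would be
    both red and blue.\<close>
  have "u \<noteq> v" using path[of x u y] e e' disj by auto
  moreover have "x \<noteq> y" using path[of u x v] e e' disj by auto
  moreover have "{u, v} \<notin> ?E" "{x, y} \<notin> ?E" using col e by blast+
  \<comment> \<open>A blue edge here would force \<open>x = y\<close>, a red one
    \<open>u = v\<close>; for \<open>{x, v}\<close> the two colours swap roles.\<close>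
  moreover have "{u, y} \<notin> ?E"
    using path[of x u y] path[of u y v] e e' calculation by (auto simp: E)
  moreover have "{x, v} \<notin> ?E"
    using path[of u x v] path[of x v y] e e' calculation by (auto simp: E)
  ultimately show ?thesis
    using e ne by (auto simp: induced_bichromatic_2K2_def)
qed

theorem theorem7:
  fixes G :: "'a two_ec_graph"
  assumes "two_edge_coloured_graph G"
  shows "chromatically_invariant G \<longleftrightarrow>
    \<not> (\<exists>x u y. induced_bichromatic_2path G x u y) \<and>
    \<not> (\<exists>u x v y. induced_bichromatic_2K2 G u x v y)"
proof
  assume "chromatically_invariant G"
  then show "\<not> (\<exists>x u y. induced_bichromatic_2path G x u y) \<and>
      \<not> (\<exists>u x v y. induced_bichromatic_2K2 G u x v y)"
    using induced_bichromatic_2path_not_invariant[OF assms]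
      induced_bichromatic_2K2_not_invariant[OF assms] by blast
next
  assume no: "\<not> (\<exists>x u y. induced_bichromatic_2path G x u y) \<and>
    \<not> (\<exists>u x v y. induced_bichromatic_2K2 G u x v y)"
  have "c \<in> colourings G k" if "c \<in> proper_colourings (underlying G) k" for c k
    using proper_colouring_conflict[OF assms that] that no unfolding colourings_def by blast
  moreover have "colourings G k \<subseteq> proper_colourings (underlying G) k" for k
    by (auto simp: colourings_def)
  ultimately show "chromatically_invariant G"
    unfolding chromatically_invariant_iff[OF assms] by blast
qed

end
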